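(* For every model $M$, the minimum positive integer $s$ such that $sM=\{sx : x\in M\}$ can be tiled by upright $2\times4\times1$ bricks exists and is $1$, $2$, or $4$. Moreover, $2M$ can be tiled by upright $2\times4\times1$ bricks if and only if every horizontal source footprint of $M$ is domino-tileable.
   Context: A model is a finite, nonempty union $M\subset\mathbb R^3$ of unit cubes $[a,a+1]\times[b,b+1]\times[c,c+1]$ with $(a,b,c)\in\mathbb Z^3$. For each integer $c$, the horizontal source footprint of $M$ at height $c$ is the union $P_c\subset\mathbb R^2$ of the unit squares $[a,a+1]\times[b,b+1]$, $(a,b)\in\mathbb Z^2$, for which $[a,a+1]\times[b,b+1]\times[c,c+1]$ is one of the cubes of $M$. An upright $2\times4\times1$ brick is a translate by a vector of $\mathbb Z^3$ of $[0,4]\times[0,2]\times[0,1]$ or of $[0,2]\times[0,4]\times[0,1]$. A region can be tiled by such bricks if it is exactly the union of a finite collection of such bricks with pairwise disjoint interiors. No connectivity condition on the bricks is imposed (this is what is meant by a geometric tiling). A domino is a translate by a vector of $\mathbb Z^2$ of $[0,2]\times[0,1]$ or of $[0,1]\times[0,2]$. A footprint is domino-tileable if it is exactly the union of a finite collection of dominoes with pairwise disjoint interiors (the empty footprint is trivially domino-tileable). *)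

theory Defs
  imports "HOL-Analysis.Analysis"
begin

(* R^2 and R^3 are the Euclidean spaces real * real and real * real * real, so that
   boxes are literally products of closed intervals. *)

definition unit_square :: "int \<Rightarrow> int \<Rightarrow> (real \<times> real) set" where
  "unit_square a b = {real_of_int a..real_of_int a + 1} \<times> {real_of_int b..real_of_int b + 1}"

definition unit_cube :: "int \<Rightarrow> int \<Rightarrow> int \<Rightarrow> (real \<times> real \<times> real) set" where
  "unit_cube a b c = {real_of_int a..real_of_int a + 1} \<times> {real_of_int b..real_of_int b + 1}
     \<times> {real_of_int c..real_of_int c + 1}"

definition is_model :: "(real \<times> real \<times> real) set \<Rightarrow> bool" where
  "is_model M \<longleftrightarrow>
     (\<exists>C. finite C \<and> C \<noteq> {} \<and> M = (\<Union>(a, b, c)\<in>C. unit_cube a b c))"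

(* The lattice cubes making up a model are exactly the lattice cubes contained in it
   (distinct lattice cubes have disjoint interiors), so "being one of the cubes of M"
   is expressed by inclusion. *)
definition footprint :: "(real \<times> real \<times> real) set \<Rightarrow> int \<Rightarrow> (real \<times> real) set" where
  "footprint M c = \<Union>{unit_square a b | a b. unit_cube a b c \<subseteq> M}"

definition tileable_by :: "'a::euclidean_space set set \<Rightarrow> 'a set \<Rightarrow> bool" where
  "tileable_by \<B> R \<longleftrightarrow>
     (\<exists>T. finite T \<and> T \<subseteq> \<B> \<and> pairwise (\<lambda>A B. interior A \<inter> interior B = {}) T \<and> \<Union>T = R)"

definition bricks :: "(real \<times> real \<times> real) set set" where
  "bricks =
     {(+) (real_of_int a, real_of_int b, real_of_int c) ` ({0..4} \<times> {0..2} \<times> {0..1}) | a b c. True} \<union>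
     {(+) (real_of_int a, real_of_int b, real_of_int c) ` ({0..2} \<times> {0..4} \<times> {0..1}) | a b c. True}"

definition dominoes :: "(real \<times> real) set set" where
  "dominoes =
     {(+) (real_of_int a, real_of_int b) ` ({0..2} \<times> {0..1}) | a b. True} \<union>
     {(+) (real_of_int a, real_of_int b) ` ({0..1} \<times> {0..2}) | a b. True}"

abbreviation brick_tileable :: "(real \<times> real \<times> real) set \<Rightarrow> bool" where
  "brick_tileable \<equiv> tileable_by bricks"

abbreviation domino_tileable :: "(real \<times> real) set \<Rightarrow> bool" where
  "domino_tileable \<equiv> tileable_by dominoes"

definition scaled :: "nat \<Rightarrow> (real \<times> real \<times> real) set \<Rightarrow> (real \<times> real \<times> real) set" where
  "scaled s M = {real s *\<^sub>R x | x. x \<in> M}"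

end

theory Submission
  imports Defs
begin

text \<open>
  A geometric tiling of a union of lattice cells by unions of lattice cells is the same thing as a
  partition of the corresponding set of integer index tuples (lemma \<open>tileable_by_region_iff\<close>). Since
  bricks have height one, a tiling of \<open>sM\<close> is an independent choice, for every integer height, of a
  planar tiling by \<open>2 \<times> 4\<close> and \<open>4 \<times> 2\<close> rectangles; the layers of \<open>sM\<close> are the footprints of \<open>M\<close>
  magnified by \<open>s\<close>, each repeated \<open>s\<close> times (lemma \<open>brick_tileable_scaled_iff\<close>). So everything
  happens in the plane, for a finite set \<open>P\<close> of cells and its magnifications \<open>sP\<close>.

  Cut every rectangle into two \<open>2 \<times> 2\<close> squares, and record a tiling by such squares by the indicator
  \<open>t\<close> of their lower left corners. The tiling condition says that \<open>t\<close>, summed over the four corners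
  whose square covers a cell, is the indicator of the region; it is the composition of two
  one-dimensional conditions of the form \<open>u x + u (x - 1) = g (x div s)\<close>, one per coordinate.

  \<^item> For \<open>s = 2\<close>, subtracting consecutive equations makes \<open>u\<close> periodic on the odd numbers, hence zero
    there because \<open>u\<close> has finite support. Thus all squares in a tiling of \<open>2P\<close> sit at even
    positions, all rectangles are doubled dominoes, and halving gives a domino tiling of \<open>P\<close>; the
    converse is doubling (lemma \<open>blow_up_2_brick_bases_iff\<close>).
  \<^item> For \<open>s = 3\<close>, the same subtraction gives \<open>u (3a) + u (3(a - 1)) = g a\<close>. Hence those squares of a
    tiling of \<open>3P\<close> whose corners are multiples of three are a threefold magnified set of corners
    of a tiling of \<open>P\<close> by \<open>2 \<times> 2\<close> squares (lemma \<open>squares_blow_up_3\<close>). Each of these squares is two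
    dominoes, so \<open>2P\<close> is tileable as well, and the least scale is never three.
  \<^item> For \<open>s = 4\<close>, the set \<open>2P\<close> is a union of \<open>2 \<times> 2\<close> squares, hence of dominoes, and the case of
    doubling applies to \<open>4P = 2(2P)\<close>.
\<close>

section \<open>Tilings of sets\<close>

definition tiling :: "'c set set \<Rightarrow> 'c set \<Rightarrow> bool" where
  "tiling T R \<longleftrightarrow> pairwise disjnt T \<and> \<Union>T = R"

definition set_tileable :: "'c set set \<Rightarrow> 'c set \<Rightarrow> bool" where
  "set_tileable \<D> R \<longleftrightarrow> (\<exists>T\<subseteq>\<D>. tiling T R)"

lemma set_tileableI: "T \<subseteq> \<D> \<Longrightarrow> tiling T R \<Longrightarrow> set_tileable \<D> R"
  unfolding set_tileable_def by blast

lemma tiling_unique: "tiling T R \<Longrightarrow> A \<in> T \<Longrightarrow> B \<in> T \<Longrightarrow> x \<in> A \<Longrightarrow> x \<in> B \<Longrightarrow> A = B"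
  unfolding tiling_def pairwise_def disjnt_def by blast

lemma tilingI:
  assumes "\<And>A B x. A \<in> T \<Longrightarrow> B \<in> T \<Longrightarrow> x \<in> A \<Longrightarrow> x \<in> B \<Longrightarrow> A = B" and "\<Union>T = R"
  shows "tiling T R"
  using assms unfolding tiling_def pairwise_def disjnt_def by blast

lemma tiling_refine:
  assumes T: "tiling T R" and H: "\<And>D. D \<in> T \<Longrightarrow> tiling (H D) D"
  shows "tiling (\<Union>D\<in>T. H D) R"
proof (rule tilingI)
  fix A B x
  assume "A \<in> (\<Union>D\<in>T. H D)" "B \<in> (\<Union>D\<in>T. H D)" and x: "x \<in> A" "x \<in> B"
  then obtain D E where D: "D \<in> T" "A \<in> H D" and E: "E \<in> T" "B \<in> H E" by blast
  have "x \<in> D" "x \<in> E" using H[OF D(1)] H[OF E(1)] D E x unfolding tiling_def by blast+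
  hence "D = E" using tiling_unique[OF T] D E by blast
  thus "A = B" using tiling_unique[OF H[OF D(1)]] D E x by blast
next
  have "\<And>D. D \<in> T \<Longrightarrow> \<Union>(H D) = D" using H unfolding tiling_def by blast
  thus "\<Union>(\<Union>D\<in>T. H D) = R" using T unfolding tiling_def by blast
qed

lemma set_tileable_refine:
  assumes "set_tileable \<D> R" and "\<And>D. D \<in> \<D> \<Longrightarrow> set_tileable \<E> D"
  shows "set_tileable \<E> R"
proof -
  obtain T where T: "T \<subseteq> \<D>" "tiling T R" using assms(1) unfolding set_tileable_def by blast
  obtain H where H: "\<And>D. D \<in> \<D> \<Longrightarrow> H D \<subseteq> \<E> \<and> tiling (H D) D"
    using assms(2) unfolding set_tileable_def by metis
  show ?thesis
    by (rule set_tileableI[OF _ tiling_refine[OF T(2), of H]]) (use H T in blast)+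
qed

text \<open>Magnification of a set of cells is a preimage under coordinatewise integer division, so this
  transports tilings between a set and its magnification, in both directions.\<close>

lemma tiling_vimage:
  assumes "surj f"
  shows "tiling ((-`) f ` T) (f -` R) \<longleftrightarrow> tiling T R"
proof -
  have inj: "f -` A = f -` B \<longleftrightarrow> A = B" for A B
    using assms by (metis surj_image_vimage_eq)
  have "disjnt (f -` A) (f -` B) \<longleftrightarrow> disjnt A B" for A B
    using inj[of "A \<inter> B" "{}"] by (simp add: disjnt_def)
  hence "pairwise disjnt ((-`) f ` T) \<longleftrightarrow> pairwise disjnt T"
    by (simp add: pairwise_image pairwise_def inj)
  moreover have "\<Union>((-`) f ` T) = f -` \<Union>T" by blast
  ultimately show ?thesis by (simp add: tiling_def inj)
qed

section \<open>From geometric tilings to tilings of sets of cells\<close>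

text \<open>The squares of the plane and the cubes of space enter the argument only through the following
  properties, so both dimensions are treated at once. Cells may overlap in their boundaries.\<close>

locale lattice_cells =
  fixes cell :: "'c \<Rightarrow> 'a::euclidean_space set"
  assumes closed_cell: "closed (cell q)"
    and interior_cell: "interior (cell q) \<noteq> {}"
    and interior_cells_disjoint: "q \<noteq> r \<Longrightarrow> interior (cell q) \<inter> interior (cell r) = {}"
begin

definition region :: "'c set \<Rightarrow> 'a set" where
  "region D = \<Union>(cell ` D)"

text \<open>The intersection is a finite union of intersections of two different cells. Each of these is
  closed with empty interior, and such sets are stable under finite unions.\<close>

lemma interior_region_Int:
  assumes "finite D" "finite E" "D \<inter> E = {}"
  shows "interior (region D \<inter> region E) = {}"
proof -
  have "interior (\<Union>(q,r)\<in>F. cell q \<inter> cell r) = {}" if "finite F" "F \<subseteq> D \<times> E" for F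
    using that
  proof (induction F)
    case (insert p F)
    obtain q r where p: "p = (q, r)" by (cases p)
    have "q \<noteq> r" using insert.prems p assms(3) by auto
    hence "interior (cell q \<inter> cell r) = {}" by (simp add: interior_cells_disjoint)
    moreover have "closed (cell q \<inter> cell r)" by (simp add: closed_cell closed_Int)
    ultimately show ?case
      using insert by (simp add: p interior_closed_Un_empty_interior)
  qed simp
  moreover have "region D \<inter> region E = (\<Union>(q,r)\<in>D \<times> E. cell q \<inter> cell r)"
    unfolding region_def by blast
  ultimately show ?thesis using assms by simp
qed

text \<open>A cell whose index is missing meets the region in a set without interior points, so it cannot
  lie inside. A finite index set can thus be read off from the region that it spans.\<close>

lemma cell_subset_region_iff:
  assumes "finite D"
  shows "cell q \<subseteq> region D \<longleftrightarrow> q \<in> D"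
proof
  assume sub: "cell q \<subseteq> region D"
  show "q \<in> D"
  proof (rule ccontr)
    assume "q \<notin> D"
    hence "interior (region {q} \<inter> region D) = {}" using assms by (intro interior_region_Int) auto
    moreover have "region {q} \<inter> region D = cell q" using sub by (auto simp: region_def)
    ultimately show False using interior_cell by simp
  qed
qed (auto simp: region_def)

lemma region_inject: "finite D \<Longrightarrow> finite E \<Longrightarrow> region D = region E \<longleftrightarrow> D = E"
  using cell_subset_region_iff by (metis set_eqI)

lemma interior_region_disjoint_iff:
  assumes "finite D" "finite E"
  shows "interior (region D) \<inter> interior (region E) = {} \<longleftrightarrow> disjnt D E"
proof
  assume dis: "interior (region D) \<inter> interior (region E) = {}"
  have "interior (cell q) \<subseteq> interior (region D) \<inter> interior (region E)" if "q \<in> D \<inter> E" for q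
    using that assms by (simp add: cell_subset_region_iff interior_mono)
  thus "disjnt D E" using dis interior_cell unfolding disjnt_def by blast
next
  assume "disjnt D E"
  thus "interior (region D) \<inter> interior (region E) = {}"
    using interior_region_Int[OF assms] by (simp add: disjnt_def)
qed

lemma region_Union: "region (\<Union>T) = \<Union>(region ` T)"
  unfolding region_def by blast

text \<open>Finite sets of cells correspond faithfully to their regions, by injectivity and by the
  characterisation of disjoint interiors; finiteness of the family of tiles is automatic on the
  side of cells because the tiles partition a finite set.\<close>

lemma tileable_by_region_iff:
  assumes R: "finite R" and \<D>: "\<And>D. D \<in> \<D> \<Longrightarrow> finite D"
  shows "tileable_by (region ` \<D>) (region R) \<longleftrightarrow> set_tileable \<D> R"
proof
  assume "tileable_by (region ` \<D>) (region R)"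
  then obtain T where T: "finite T" "T \<subseteq> region ` \<D>" "\<Union>T = region R"
    and dis: "pairwise (\<lambda>A B. interior A \<inter> interior B = {}) T"
    unfolding tileable_by_def by blast
  obtain U where U: "U \<subseteq> \<D>" "finite U" "T = region ` U"
    using finite_subset_image[OF T(1,2)] by blast
  have finU: "finite D" if "D \<in> U" for D using \<D> U that by blast
  have disU: "pairwise disjnt U"
  proof (rule pairwiseI)
    fix D E assume DE: "D \<in> U" "E \<in> U" "D \<noteq> E"
    hence "region D \<noteq> region E" using region_inject[OF finU finU] by simp
    hence "interior (region D) \<inter> interior (region E) = {}"
      using pairwiseD[OF dis] DE U(3) by blast
    thus "disjnt D E" using interior_region_disjoint_iff[OF finU finU] DE by blast
  qed
  have "region (\<Union>U) = region R" using T(3) U(3) by (simp add: region_Union)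
  moreover have "finite (\<Union>U)" using U(2) finU by blast
  ultimately have "\<Union>U = R" using region_inject R by metis
  hence "tiling U R" using disU unfolding tiling_def by blast
  thus "set_tileable \<D> R" by (rule set_tileableI[OF U(1)])
next
  assume "set_tileable \<D> R"
  then obtain U where U: "U \<subseteq> \<D>" "pairwise disjnt U" "\<Union>U = R"
    unfolding set_tileable_def tiling_def by blast
  have "finite U" using finite_UnionD[of U] R U(3) by simp
  moreover have "pairwise (\<lambda>A B. interior A \<inter> interior B = {}) (region ` U)"
  proof (rule pairwiseI)
    fix A B assume "A \<in> region ` U" "B \<in> region ` U" "A \<noteq> B"
    then obtain D E where DE: "D \<in> U" "E \<in> U" "D \<noteq> E" "A = region D" "B = region E" by blast
    have "disjnt D E" using pairwiseD[OF U(2)] DE by blast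
    moreover have "finite D" "finite E" using DE U(1) \<D> by blast+
    ultimately show "interior A \<inter> interior B = {}"
      using interior_region_disjoint_iff DE(4,5) by blast
  qed
  moreover have "region ` U \<subseteq> region ` \<D>" "\<Union>(region ` U) = region R"
    using U(1) region_Union[of U] U(3) by auto
  ultimately show "tileable_by (region ` \<D>) (region R)"
    unfolding tileable_by_def by blast
qed

end

section \<open>Squares, cubes and their unions\<close>

definition segment :: "int \<Rightarrow> real set" where
  "segment i = {real_of_int i..real_of_int i + 1}"

lemma interior_segments_disjoint: "i \<noteq> j \<Longrightarrow> interior (segment i) \<inter> interior (segment j) = {}"
  unfolding segment_def interior_atLeastAtMost_real by fastforce

lemma interior_segment: "interior (segment i) \<noteq> {}"
  unfolding segment_def interior_atLeastAtMost_real by simp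

lemma interval_eq_segments:
  assumes "a < b"
  shows "{real_of_int a..real_of_int b} = (\<Union>i\<in>{a..<b}. segment i)"
proof (intro set_eqI iffI)
  fix x assume x: "x \<in> {real_of_int a..real_of_int b}"
  show "x \<in> (\<Union>i\<in>{a..<b}. segment i)"
  proof (cases "x = real_of_int b")
    case True
    thus ?thesis using assms by (auto simp: segment_def intro!: bexI[of _ "b - 1"])
  next
    case False
    hence "\<lfloor>x\<rfloor> \<in> {a..<b}" using x by (auto simp: le_floor_iff floor_less_iff)
    moreover have "x \<in> segment \<lfloor>x\<rfloor>" unfolding segment_def by (auto simp: less_imp_le)
    ultimately show ?thesis by blast
  qed
next
  fix x assume "x \<in> (\<Union>i\<in>{a..<b}. segment i)"
  then obtain i where i: "a \<le> i" "i + 1 \<le> b" "real_of_int i \<le> x" "x \<le> real_of_int (i + 1)"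
    by (auto simp: segment_def)
  thus "x \<in> {real_of_int a..real_of_int b}"
    by (metis atLeastAtMost_iff of_int_le_iff order_trans)
qed

abbreviation square_cell :: "int \<times> int \<Rightarrow> (real \<times> real) set" where
  "square_cell \<equiv> \<lambda>(a, b). unit_square a b"

abbreviation cube_cell :: "int \<times> int \<times> int \<Rightarrow> (real \<times> real \<times> real) set" where
  "cube_cell \<equiv> \<lambda>(a, b, c). unit_cube a b c"

lemma unit_square_eq: "unit_square a b = segment a \<times> segment b"
  and unit_cube_eq: "unit_cube a b c = segment a \<times> segment b \<times> segment c"
  unfolding unit_square_def unit_cube_def segment_def by simp_all

lemma closed_segment_int: "closed (segment i)"
  unfolding segment_def by simp

interpretation plane: lattice_cells square_cell
proof
  fix q r :: "int \<times> int"
  show "closed (square_cell q)"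
    by (cases q) (simp add: unit_square_eq closed_Times closed_segment_int)
  show "interior (square_cell q) \<noteq> {}"
    by (cases q) (simp add: unit_square_eq interior_Times interior_segment)
  assume "q \<noteq> r"
  thus "interior (square_cell q) \<inter> interior (square_cell r) = {}"
    using interior_segments_disjoint
    by (cases q; cases r) (auto simp: unit_square_eq interior_Times Times_Int_Times)
qed

interpretation space: lattice_cells cube_cell
proof
  fix q r :: "int \<times> int \<times> int"
  show "closed (cube_cell q)"
    by (cases q) (simp add: unit_cube_eq closed_Times closed_segment_int)
  show "interior (cube_cell q) \<noteq> {}"
    by (cases q) (simp add: unit_cube_eq interior_Times interior_segment)
  assume "q \<noteq> r"
  thus "interior (cube_cell q) \<inter> interior (cube_cell r) = {}"
    using interior_segments_disjoint
    by (cases q; cases r) (auto simp: unit_cube_eq interior_Times Times_Int_Times)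
qed

lemma mem_plane_region:
  "(x, y) \<in> plane.region D \<longleftrightarrow> (\<exists>a b. (a, b) \<in> D \<and> x \<in> segment a \<and> y \<in> segment b)"
  unfolding plane.region_def by (force simp: unit_square_eq)

lemma mem_space_region:
  "(x, y, z) \<in> space.region D \<longleftrightarrow>
    (\<exists>a b c. (a, b, c) \<in> D \<and> x \<in> segment a \<and> y \<in> segment b \<and> z \<in> segment c)"
  unfolding space.region_def by (force simp: unit_cube_eq)

definition rect :: "int \<Rightarrow> int \<Rightarrow> int \<Rightarrow> int \<Rightarrow> (int \<times> int) set" where
  "rect w h a b = {a..<a + w} \<times> {b..<b + h}"

definition layer :: "int \<Rightarrow> (int \<times> int) set \<Rightarrow> (int \<times> int \<times> int) set" where
  "layer z D = {(x, y, z) | x y. (x, y) \<in> D}"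

lemma mem_layer: "(x, y, w) \<in> layer z D \<longleftrightarrow> w = z \<and> (x, y) \<in> D"
  unfolding layer_def by auto

definition domino_cells :: "(int \<times> int) set set" where
  "domino_cells = {rect 2 1 a b | a b. True} \<union> {rect 1 2 a b | a b. True}"

definition brick_bases :: "(int \<times> int) set set" where
  "brick_bases = {rect 4 2 a b | a b. True} \<union> {rect 2 4 a b | a b. True}"

definition brick_cells :: "(int \<times> int \<times> int) set set" where
  "brick_cells = {layer z D | z D. D \<in> brick_bases}"

lemma translate_interval: "(+) (real_of_int a) ` {0..real_of_int n} = {real_of_int a..real_of_int (a + n)}"
  by simp

lemma translate_Times: "(+) (x, y) ` (A \<times> B) = ((+) x ` A) \<times> ((+) y ` B)"
  by (force simp: image_iff)

lemma region_rect:
  assumes "0 < w" "0 < h"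
  shows "plane.region (rect w h a b) =
    (+) (real_of_int a, real_of_int b) ` ({0..real_of_int w} \<times> {0..real_of_int h})"
proof -
  have "plane.region (rect w h a b) = (\<Union>i\<in>{a..<a+w}. segment i) \<times> (\<Union>j\<in>{b..<b+h}. segment j)"
    unfolding set_eq_iff split_paired_All mem_plane_region rect_def by blast
  thus ?thesis
    unfolding translate_Times translate_interval using assms
    by (simp add: interval_eq_segments[symmetric])
qed

lemma region_layer_rect:
  assumes "0 < w" "0 < h"
  shows "space.region (layer c (rect w h a b)) =
    (+) (real_of_int a, real_of_int b, real_of_int c) `
      ({0..real_of_int w} \<times> {0..real_of_int h} \<times> {0..1})"
proof -
  have "space.region (layer c (rect w h a b)) =
     (\<Union>i\<in>{a..<a+w}. segment i) \<times> (\<Union>j\<in>{b..<b+h}. segment j) \<times> segment c"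
    unfolding set_eq_iff split_paired_All mem_space_region rect_def mem_layer by blast
  also have "segment c = (+) (real_of_int c) ` {0..1}" by (simp add: segment_def)
  finally show ?thesis
    unfolding translate_Times translate_interval using assms
    by (simp add: interval_eq_segments[symmetric])
qed

lemma dominoes_eq: "dominoes = plane.region ` domino_cells"
proof -
  have "plane.region ` domino_cells = {plane.region (rect 2 1 a b) | a b. True} \<union>
      {plane.region (rect 1 2 a b) | a b. True}"
    unfolding domino_cells_def by blast
  thus ?thesis unfolding dominoes_def by (simp only: region_rect) simp
qed

lemma bricks_eq: "bricks = space.region ` brick_cells"
proof -
  have "space.region ` brick_cells = {space.region (layer c (rect 4 2 a b)) | a b c. True} \<union>
      {space.region (layer c (rect 2 4 a b)) | a b c. True}"
    unfolding brick_cells_def brick_bases_def by blast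
  thus ?thesis unfolding bricks_def by (simp only: region_layer_rect) simp
qed

lemma finite_rect: "finite (rect w h a b)"
  unfolding rect_def by simp

lemma finite_domino_cells: "D \<in> domino_cells \<Longrightarrow> finite D"
  unfolding domino_cells_def by (auto simp: finite_rect)

lemma finite_brick_cells: "D \<in> brick_cells \<Longrightarrow> finite D"
proof -
  have "layer z E = (\<lambda>(x, y). (x, y, z)) ` E" for z E unfolding layer_def by auto
  thus "D \<in> brick_cells \<Longrightarrow> finite D"
    unfolding brick_cells_def brick_bases_def by (auto simp: finite_rect)
qed

section \<open>Scaling and slicing\<close>

definition blow_up :: "nat \<Rightarrow> (int \<times> int) set \<Rightarrow> (int \<times> int) set" where
  "blow_up s P = (\<lambda>(x, y). (x div int s, y div int s)) -` P"

definition blow_up3 :: "nat \<Rightarrow> (int \<times> int \<times> int) set \<Rightarrow> (int \<times> int \<times> int) set" where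
  "blow_up3 s C = (\<lambda>(x, y, z). (x div int s, y div int s, z div int s)) -` C"

definition slice :: "int \<Rightarrow> (int \<times> int \<times> int) set \<Rightarrow> (int \<times> int) set" where
  "slice z C = (\<lambda>(x, y). (x, y, z)) -` C"

lemma le_div_int_iff:
  assumes "0 < s"
  shows "a \<le> x div int s \<longleftrightarrow> int s * a \<le> x"
proof
  assume "a \<le> x div int s"
  hence "int s * a \<le> int s * (x div int s)" by (simp add: mult_left_mono)
  also have "\<dots> \<le> x" using assms by (simp add: minus_mod_eq_mult_div[symmetric])
  finally show "int s * a \<le> x" .
next
  assume "int s * a \<le> x"
  hence "int s * a div int s \<le> x div int s" using assms by (intro zdiv_mono1) simp_all
  thus "a \<le> x div int s" using assms by simp
qed

lemma div_int_less_iff: "0 < s \<Longrightarrow> x div int s < a \<longleftrightarrow> x < int s * a"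
  using le_div_int_iff[of s a x] by linarith

lemma div_eq_iff_interval: "0 < s \<Longrightarrow> k div int s = i \<longleftrightarrow> k \<in> {int s * i..<int s * i + int s}"
  using le_div_int_iff[of s i k] div_int_less_iff[of s k "i + 1"] by (auto simp: distrib_left)

lemma finite_blow_up3:
  assumes "finite C" "0 < s"
  shows "finite (blow_up3 s C)"
proof -
  define I where "I i = {int s * i..<int s * i + int s}" for i
  have I: "k \<in> I (k div int s)" for k
    using div_eq_iff_interval[OF assms(2), of k] unfolding I_def by blast
  have "blow_up3 s C \<subseteq> (\<Union>(a, b, c)\<in>C. I a \<times> I b \<times> I c)"
  proof
    fix p assume "p \<in> blow_up3 s C"
    then obtain x y z where p: "p = (x, y, z)" "(x div int s, y div int s, z div int s) \<in> C"
      by (cases p) (simp add: blow_up3_def)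
    show "p \<in> (\<Union>(a, b, c)\<in>C. I a \<times> I b \<times> I c)"
      by (rule UN_I[OF p(2)]) (simp add: p I)
  qed
  moreover have "finite (\<Union>(a, b, c)\<in>C. I a \<times> I b \<times> I c)"
    using assms(1) by (auto simp: I_def)
  ultimately show ?thesis by (rule finite_subset)
qed

lemma finite_slice: "finite C \<Longrightarrow> finite (slice z C)"
  unfolding slice_def by (rule finite_vimageI) (auto simp: inj_on_def)

lemma surj_div_pair: "0 < s \<Longrightarrow> surj (\<lambda>(x, y). (x div int s, y div int s))"
  by (rule surjI[where f = "\<lambda>(x, y). (x * int s, y * int s)"]) auto

text \<open>A planar magnification is a layer of a spatial one.\<close>

lemma finite_blow_up:
  assumes "finite P" "0 < s"
  shows "finite (blow_up s P)"
proof -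
  have "blow_up s P = slice 0 (blow_up3 s ((\<lambda>(x, y). (x, y, 0)) ` P))"
    unfolding blow_up_def slice_def blow_up3_def by (force simp: image_iff)
  thus ?thesis using assms by (simp add: finite_slice finite_blow_up3)
qed

lemma slice_blow_up3: "slice z (blow_up3 s C) = blow_up s (slice (z div int s) C)"
  unfolding slice_def blow_up3_def blow_up_def by auto

lemma divide_in_segment_iff:
  assumes "0 < s"
  shows "x / real s \<in> segment i \<longleftrightarrow> (\<exists>k. k div int s = i \<and> x \<in> segment k)"
proof -
  have "x / real s \<in> segment i \<longleftrightarrow> x \<in> {real_of_int (int s * i)..real_of_int (int s * i + int s)}"
    using assms by (auto simp: segment_def field_simps)
  also have "\<dots> \<longleftrightarrow> (\<exists>k\<in>{int s * i..<int s * i + int s}. x \<in> segment k)"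
    using assms by (subst interval_eq_segments) auto
  finally show ?thesis using div_eq_iff_interval[OF assms] by blast
qed

lemma scaled_region:
  assumes "0 < s"
  shows "scaled s (space.region C) = space.region (blow_up3 s C)"
proof (rule set_eqI)
  fix p :: "real \<times> real \<times> real"
  obtain x y z where p: "p = (x, y, z)" by (cases p)
  have "p = real s *\<^sub>R q \<longleftrightarrow> q = (x / real s, y / real s, z / real s)" for q
    using assms unfolding p by (cases q) (auto simp: field_simps)
  hence "p \<in> scaled s (space.region C) \<longleftrightarrow> (x / real s, y / real s, z / real s) \<in> space.region C"
    unfolding scaled_def mem_Collect_eq by metis
  also have "\<dots> \<longleftrightarrow> p \<in> space.region (blow_up3 s C)"
    unfolding p mem_space_region divide_in_segment_iff[OF assms] blow_up3_def by auto
  finally show "p \<in> scaled s (space.region C) \<longleftrightarrow> p \<in> space.region (blow_up3 s C)" .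
qed

lemma footprint_region:
  assumes "finite C"
  shows "footprint (space.region C) c = plane.region (slice c C)"
proof -
  have "unit_cube a b c \<subseteq> space.region C \<longleftrightarrow> (a, b) \<in> slice c C" for a b
    using space.cell_subset_region_iff[OF assms, of "(a, b, c)"] by (simp add: slice_def)
  thus ?thesis unfolding footprint_def plane.region_def by auto
qed

text \<open>A brick lies in a single layer, so the layers can be tiled independently.\<close>

lemma set_tileable_brick_cells_iff:
  "set_tileable brick_cells R \<longleftrightarrow> (\<forall>z. set_tileable brick_bases (slice z R))"
proof (intro iffI allI)
  fix z assume "set_tileable brick_cells R"
  then obtain T where T: "T \<subseteq> brick_cells" "tiling T R" unfolding set_tileable_def by blast
  let ?U = "{D \<in> brick_bases. layer z D \<in> T}"
  have "tiling ?U (slice z R)"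
  proof (rule tilingI)
    fix A B p assume AB: "A \<in> ?U" "B \<in> ?U" "p \<in> A" "p \<in> B"
    obtain x y where p: "p = (x, y)" by (cases p)
    have "layer z A = layer z B"
      using tiling_unique[OF T(2), of "layer z A" "layer z B" "(x, y, z)"] AB p
      by (auto simp: layer_def)
    thus "A = B" by (auto simp: layer_def set_eq_iff)
  next
    have "(x, y) \<in> \<Union>?U \<longleftrightarrow> (x, y, z) \<in> \<Union>T" for x y
    proof
      assume "(x, y, z) \<in> \<Union>T"
      then obtain w D where "layer w D \<in> T" "(x, y, z) \<in> layer w D" "D \<in> brick_bases"
        using T(1) unfolding brick_cells_def by blast
      thus "(x, y) \<in> \<Union>?U" by (auto simp: layer_def)
    next
      assume "(x, y) \<in> \<Union>?U"
      thus "(x, y, z) \<in> \<Union>T" using mem_layer by blast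
    qed
    hence "(x, y) \<in> \<Union>?U \<longleftrightarrow> (x, y) \<in> slice z R" for x y
      using T(2) by (simp only: tiling_def slice_def vimage_eq prod.case)
    thus "\<Union>?U = slice z R" unfolding set_eq_iff split_paired_All by blast
  qed
  thus "set_tileable brick_bases (slice z R)" by (rule set_tileableI[rotated]) blast
next
  assume "\<forall>z. set_tileable brick_bases (slice z R)"
  then obtain U where U: "\<And>z. U z \<subseteq> brick_bases" "\<And>z. tiling (U z) (slice z R)"
    unfolding set_tileable_def by metis
  let ?T = "{layer z D | z D. D \<in> U z}"
  have "tiling ?T R"
  proof (rule tilingI)
    fix A B p assume "A \<in> ?T" "B \<in> ?T" and p: "p \<in> A" "p \<in> B"
    then obtain z D w E where DE: "A = layer z D" "D \<in> U z" "B = layer w E" "E \<in> U w" by blast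
    obtain x y where "p = (x, y, z)" "w = z" "(x, y) \<in> D" "(x, y) \<in> E"
      using p DE by (auto simp: layer_def)
    thus "A = B" using tiling_unique[OF U(2)] DE by blast
  next
    have "(x, y, z) \<in> \<Union>?T \<longleftrightarrow> (x, y) \<in> \<Union>(U z)" for x y z unfolding layer_def by auto
    hence "(x, y, z) \<in> \<Union>?T \<longleftrightarrow> (x, y, z) \<in> R" for x y z
      using U(2)[of z] by (simp only: tiling_def slice_def vimage_eq prod.case)
    thus "\<Union>?T = R" unfolding set_eq_iff split_paired_All by blast
  qed
  thus "set_tileable brick_cells R"
    by (rule set_tileableI[rotated]) (use U(1) in \<open>auto simp: brick_cells_def\<close>)
qed

text \<open>The reduction to the plane: the layers of the magnified model at the heights \<open>cs, ..., cs + s - 1\<close>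
  all equal the magnified footprint at height \<open>c\<close>.\<close>

lemma brick_tileable_scaled_iff:
  assumes "finite C" "0 < s"
  shows "brick_tileable (scaled s (space.region C)) \<longleftrightarrow>
    (\<forall>c. set_tileable brick_bases (blow_up s (slice c C)))"
proof -
  have "brick_tileable (scaled s (space.region C)) \<longleftrightarrow> set_tileable brick_cells (blow_up3 s C)"
    unfolding bricks_eq scaled_region[OF assms(2)]
    by (rule space.tileable_by_region_iff) (auto intro: finite_blow_up3 assms finite_brick_cells)
  also have "\<dots> \<longleftrightarrow> (\<forall>z. set_tileable brick_bases (blow_up s (slice (z div int s) C)))"
    by (simp add: set_tileable_brick_cells_iff slice_blow_up3)
  also have "\<dots> \<longleftrightarrow> (\<forall>c. set_tileable brick_bases (blow_up s (slice c C)))"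
    using assms(2) by (metis nonzero_mult_div_cancel_right of_nat_0_less_iff less_irrefl)
  finally show ?thesis .
qed

section \<open>Tilings by two-by-two squares\<close>

definition squares :: "(int \<times> int) set set" where
  "squares = {rect 2 2 a b | a b. True}"

lemma rect_inject: "0 < w \<Longrightarrow> 0 < h \<Longrightarrow> rect w h a b = rect w h a' b' \<longleftrightarrow> a = a' \<and> b = b'"
  unfolding rect_def by (auto simp: times_eq_iff atLeastLessThan_eq_iff)

text \<open>A \<open>2 \<times> 2\<close> square covers \<open>(x, y)\<close> precisely if its lower left corner is one of the four points
  below. With \<open>Q\<close> the set of corners of a family of squares, this is the number of squares that
  cover \<open>(x, y)\<close>, and tilings become the solutions of a linear equation.\<close>

abbreviation anchor_count :: "(int \<times> int) set \<Rightarrow> int \<Rightarrow> int \<Rightarrow> int" where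
  "anchor_count Q x y \<equiv> of_bool ((x, y) \<in> Q) + of_bool ((x - 1, y) \<in> Q)
     + of_bool ((x, y - 1) \<in> Q) + of_bool ((x - 1, y - 1) \<in> Q)"

lemma mem_square_iff: "(x, y) \<in> rect 2 2 a b \<longleftrightarrow> (a = x \<or> a = x - 1) \<and> (b = y \<or> b = y - 1)"
  unfolding rect_def by auto

lemma anchor_count_of_tiling:
  assumes T: "tiling T R" "T \<subseteq> squares"
  shows "anchor_count {(a, b). rect 2 2 a b \<in> T} x y = of_bool ((x, y) \<in> R)"
proof -
  have uniq: "a = a' \<and> b = b'" if "rect 2 2 a b \<in> T" "rect 2 2 a' b' \<in> T"
    "(x, y) \<in> rect 2 2 a b" "(x, y) \<in> rect 2 2 a' b'" for a b a' b'
    using tiling_unique[OF T(1) that] by (simp add: rect_inject)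
  have "(x, y) \<in> R \<longleftrightarrow> (\<exists>a b. rect 2 2 a b \<in> T \<and> (x, y) \<in> rect 2 2 a b)"
    using T unfolding tiling_def squares_def by blast
  hence R: "(x, y) \<in> R \<longleftrightarrow> rect 2 2 x y \<in> T \<or> rect 2 2 (x - 1) y \<in> T \<or> rect 2 2 x (y - 1) \<in> T
      \<or> rect 2 2 (x - 1) (y - 1) \<in> T"
    unfolding mem_square_iff by blast
  show ?thesis
    using uniq[of x y "x - 1" y] uniq[of x y x "y - 1"] uniq[of x y "x - 1" "y - 1"]
      uniq[of "x - 1" y x "y - 1"] uniq[of "x - 1" y "x - 1" "y - 1"] uniq[of x "y - 1" "x - 1" "y - 1"]
    unfolding R by (auto simp: mem_square_iff)
qed

lemma set_tileable_squares_of_anchor_count: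
  assumes "\<And>x y. anchor_count Q x y = of_bool ((x, y) \<in> R)"
  shows "set_tileable squares R"
proof (rule set_tileableI)
  let ?T = "{rect 2 2 a b | a b. (a, b) \<in> Q}"
  show "?T \<subseteq> squares" unfolding squares_def by blast
  show "tiling ?T R"
  proof (rule tilingI)
    fix A B p assume "A \<in> ?T" "B \<in> ?T" and p: "p \<in> A" "p \<in> B"
    then obtain a b a' b' where ab: "A = rect 2 2 a b" "(a, b) \<in> Q" "B = rect 2 2 a' b'" "(a', b') \<in> Q"
      by blast
    obtain x y where xy: "p = (x, y)" by (cases p)
    have "anchor_count Q x y \<le> 1" by (simp only: assms) simp
    moreover have "(a = x \<or> a = x - 1) \<and> (b = y \<or> b = y - 1)"
      "(a' = x \<or> a' = x - 1) \<and> (b' = y \<or> b' = y - 1)"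
      using p ab xy by (simp_all add: mem_square_iff)
    ultimately have "a = a' \<and> b = b'" using ab(2,4) by (auto simp: of_bool_def split: if_splits)
    thus "A = B" using ab by simp
  next
    have "(x, y) \<in> \<Union>?T \<longleftrightarrow> (x, y) \<in> R" for x y
    proof -
      have "(x, y) \<in> \<Union>?T \<longleftrightarrow> (\<exists>a b. (a, b) \<in> Q \<and> (x, y) \<in> rect 2 2 a b)" by blast
      also have "\<dots> \<longleftrightarrow> anchor_count Q x y \<noteq> 0"
        unfolding mem_square_iff by (auto simp: of_bool_def split: if_splits)
      finally show ?thesis by (simp only: assms) simp
    qed
    thus "\<Union>?T = R" unfolding set_eq_iff split_paired_All by blast
  qed
qed

text \<open>The equations at \<open>3a - 1\<close> and \<open>3a - 2\<close> have the same right-hand side, so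
  \<open>u (3a - 1) = u (3a - 3)\<close>, which is substituted into the equation at \<open>3a\<close>.\<close>

lemma pair_sums_triple:
  fixes u g :: "int \<Rightarrow> int"
  assumes "\<And>x. u x + u (x - 1) = g (x div 3)"
  shows "u (3 * a) + u (3 * (a - 1)) = g a"
proof -
  have "u (3 * a) + u (3 * a - 1) = g a" using assms[of "3 * a"] by simp
  moreover have "(3 * a - 1) div 3 = a - 1" "(3 * a - 2) div 3 = a - 1" by presburger+
  hence "u (3 * a - 1) + u (3 * a - 2) = g (a - 1)" "u (3 * a - 2) + u (3 * a - 3) = g (a - 1)"
    using assms[of "3 * a - 1"] assms[of "3 * a - 2"] by simp_all
  ultimately show ?thesis by (simp add: algebra_simps)
qed

text \<open>The equations at \<open>2k + 2\<close> and \<open>2k + 3\<close> have the same right-hand side, so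
  \<open>u (2k + 1) = u (2k + 3)\<close>: a nonzero value at one odd number would propagate to infinitely many.\<close>

lemma pair_sums_double:
  fixes u g :: "int \<Rightarrow> int"
  assumes sums: "\<And>x. u x + u (x - 1) = g (x div 2)" and fin: "finite {x. u x \<noteq> 0}" and "odd x"
  shows "u x = 0"
proof (rule ccontr)
  assume nz: "u x \<noteq> 0"
  have step: "u (x + 2) = u x" if odd: "odd x" for x
  proof -
    obtain k where k: "x = 2 * k + 1" using odd by (elim oddE)
    show ?thesis using sums[of "2 * k + 2"] sums[of "2 * k + 3"] k by (simp add: algebra_simps)
  qed
  have "u (x + 2 * int n) = u x" for n
  proof (induction n)
    case (Suc n)
    have "u (x + 2 * int n + 2) = u (x + 2 * int n)" using \<open>odd x\<close> by (intro step) simp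
    thus ?case using Suc by (simp add: algebra_simps)
  qed simp
  hence "range (\<lambda>n. x + 2 * int n) \<subseteq> {x. u x \<noteq> 0}" using nz by auto
  hence "finite (range (\<lambda>n. x + 2 * int n))" using fin by (rule finite_subset)
  moreover have "inj (\<lambda>n. x + 2 * int n)" by (simp add: inj_on_def)
  ultimately show False using finite_imageD infinite_UNIV_nat by blast
qed

text \<open>The one-dimensional identity is applied to the rows of the corner indicator and then to the
  columns of the result; the outcome is the tiling equation for the corners at multiples of
  three.\<close>

lemma squares_blow_up_3:
  assumes "set_tileable squares (blow_up 3 P)"
  shows "set_tileable squares P"
proof -
  obtain T where T: "tiling T (blow_up 3 P)" "T \<subseteq> squares"
    using assms unfolding set_tileable_def by blast
  define t :: "int \<Rightarrow> int \<Rightarrow> int" where "t x y = of_bool (rect 2 2 x y \<in> T)" for x y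
  have sum: "t x y + t (x - 1) y + t x (y - 1) + t (x - 1) (y - 1) = of_bool ((x div 3, y div 3) \<in> P)"
    for x y using anchor_count_of_tiling[OF T, of x y] by (simp add: t_def blow_up_def)
  have row: "(t (3 * a) y + t (3 * (a - 1)) y) + (t (3 * a) (y - 1) + t (3 * (a - 1)) (y - 1))
      = of_bool ((a, y div 3) \<in> P)" for a y
    using pair_sums_triple[of "\<lambda>x. t x y + t x (y - 1)" "\<lambda>i. of_bool ((i, y div 3) \<in> P)" a] sum
    by (simp add: algebra_simps)
  have key: "t (3 * a) (3 * b) + t (3 * (a - 1)) (3 * b) + t (3 * a) (3 * (b - 1))
      + t (3 * (a - 1)) (3 * (b - 1)) = of_bool ((a, b) \<in> P)" for a b
    using pair_sums_triple[of "\<lambda>y. t (3 * a) y + t (3 * (a - 1)) y" "\<lambda>j. of_bool ((a, j) \<in> P)" b] row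
    by (simp only: add.assoc)
  show ?thesis
    by (rule set_tileable_squares_of_anchor_count[where Q = "{(a, b). rect 2 2 (3 * a) (3 * b) \<in> T}"])
      (use key in \<open>simp only: t_def mem_Collect_eq prod.case\<close>)
qed

text \<open>The sum of two neighbouring values of the corner indicator vanishes at odd positions, and then
  so does each of them, being nonnegative.\<close>

lemma squares_blow_up_2_even:
  assumes "finite P" and T: "tiling T (blow_up 2 P)" "T \<subseteq> squares" and ab: "rect 2 2 a b \<in> T"
  shows "even a \<and> even b"
proof -
  define t :: "int \<Rightarrow> int \<Rightarrow> int" where "t x y = of_bool (rect 2 2 x y \<in> T)" for x y
  have sum: "t x y + t (x - 1) y + t x (y - 1) + t (x - 1) (y - 1) = of_bool ((x div 2, y div 2) \<in> P)"
    for x y using anchor_count_of_tiling[OF T, of x y] by (simp add: t_def blow_up_def)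
  have "(x, y) \<in> blow_up 2 P" if "t x y \<noteq> 0" for x y
  proof -
    have "rect 2 2 x y \<in> T" using that by (simp add: t_def)
    moreover have "(x, y) \<in> rect 2 2 x y" by (simp add: mem_square_iff)
    ultimately show ?thesis using T(1) unfolding tiling_def by blast
  qed
  moreover have "finite (blow_up 2 P)" using assms(1) by (simp add: finite_blow_up)
  ultimately have fin: "finite {(x, y). t x y \<noteq> 0}" by (auto elim!: finite_subset[rotated])
  have finx: "finite {x. t x y \<noteq> 0}" for y
    by (rule finite_subset[OF _ finite_imageI[OF fin, of fst]]) force
  have finy: "finite {y. t x y \<noteq> 0}" for x
    by (rule finite_subset[OF _ finite_imageI[OF fin, of snd]]) force
  have tab: "t a b = 1" using ab by (simp add: t_def)
  have nonneg: "t x y \<ge> 0" for x y by (simp add: t_def)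
  have "even a"
  proof (rule ccontr)
    assume "odd a"
    have "finite {x. t x b + t x (b - 1) \<noteq> 0}"
      by (rule finite_subset[OF _ finite_UnI[OF finx[of b] finx[of "b - 1"]]]) auto
    moreover have "(t x b + t x (b - 1)) + (t (x - 1) b + t (x - 1) (b - 1))
        = of_bool ((x div 2, b div 2) \<in> P)" for x
      using sum[of x b] by linarith
    ultimately have "t a b + t a (b - 1) = 0"
      by (intro pair_sums_double[where u = "\<lambda>x. t x b + t x (b - 1)"
            and g = "\<lambda>i. of_bool ((i, b div 2) \<in> P)"] \<open>odd a\<close>)
    thus False using tab nonneg[of a "b - 1"] by linarith
  qed
  moreover have "even b"
  proof (rule ccontr)
    assume "odd b"
    have "finite {y. t a y + t (a - 1) y \<noteq> 0}"
      by (rule finite_subset[OF _ finite_UnI[OF finy[of a] finy[of "a - 1"]]]) auto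
    moreover have "(t a y + t (a - 1) y) + (t a (y - 1) + t (a - 1) (y - 1))
        = of_bool ((a div 2, y div 2) \<in> P)" for y
      using sum[of a y] by linarith
    ultimately have "t a b + t (a - 1) b = 0"
      by (intro pair_sums_double[where u = "\<lambda>y. t a y + t (a - 1) y"
            and g = "\<lambda>j. of_bool ((a div 2, j) \<in> P)"] \<open>odd b\<close>)
    thus False using tab nonneg[of "a - 1" b] by linarith
  qed
  ultimately show ?thesis by blast
qed

section \<open>Bricks, dominoes and squares\<close>

lemma tiling_two: "A \<inter> B = {} \<Longrightarrow> A \<union> B = R \<Longrightarrow> tiling {A, B} R"
  by (auto simp: tiling_def pairwise_def disjnt_def)

lemma brick_base_squares:
  assumes "D \<in> brick_bases"
  shows "set_tileable squares D"
proof -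
  have "tiling {rect 2 2 a b, rect 2 2 (a + 2) b} (rect 4 2 a b)"
    "tiling {rect 2 2 a b, rect 2 2 a (b + 2)} (rect 2 4 a b)" for a b
    by (intro tiling_two; auto simp: rect_def)+
  moreover have "{rect 2 2 a b, rect 2 2 c d} \<subseteq> squares" for a b c d
    unfolding squares_def by blast
  moreover obtain a b where "D = rect 4 2 a b \<or> D = rect 2 4 a b"
    using assms unfolding brick_bases_def by blast
  ultimately show ?thesis using set_tileableI by metis
qed

lemma square_dominoes:
  assumes "D \<in> squares"
  shows "set_tileable domino_cells D"
proof -
  obtain a b where "D = rect 2 2 a b" using assms unfolding squares_def by blast
  hence "tiling {rect 2 1 a b, rect 2 1 a (b + 1)} D"
    by (intro tiling_two) (auto simp: rect_def)
  moreover have "{rect 2 1 a b, rect 2 1 a (b + 1)} \<subseteq> domino_cells"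
    unfolding domino_cells_def by blast
  ultimately show ?thesis by (rule set_tileableI[rotated])
qed

lemma blow_up_rect: "0 < s \<Longrightarrow> blow_up s (rect w h a b) = rect (int s * w) (int s * h) (int s * a) (int s * b)"
proof -
  assume s: "0 < s"
  have "x div int s \<in> {a..<a + w} \<longleftrightarrow> x \<in> {int s * a..<int s * a + int s * w}" for x a w
    using s by (simp add: le_div_int_iff div_int_less_iff distrib_left)
  thus ?thesis unfolding blow_up_def rect_def by auto
qed

text \<open>Domino tilings double to rectangle tilings. Conversely, the squares that refine a rectangle
  tiling of \<open>blow_up 2 P\<close> all sit at even positions, hence so do the rectangles, which are
  therefore doubled dominoes.\<close>

lemma blow_up_2_brick_bases_iff:
  assumes "finite P"
  shows "set_tileable brick_bases (blow_up 2 P) \<longleftrightarrow> set_tileable domino_cells P"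
proof
  assume "set_tileable domino_cells P"
  then obtain U where U: "U \<subseteq> domino_cells" "tiling U P" unfolding set_tileable_def by blast
  have "tiling (blow_up 2 ` U) (blow_up 2 P)"
    using tiling_vimage[OF surj_div_pair[of 2]] U(2) unfolding blow_up_def[abs_def] by simp
  moreover have "blow_up 2 ` U \<subseteq> brick_bases"
  proof
    fix D assume "D \<in> blow_up 2 ` U"
    then obtain a b where "D = blow_up 2 (rect 2 1 a b) \<or> D = blow_up 2 (rect 1 2 a b)"
      using U(1) unfolding domino_cells_def by blast
    hence "D = rect 4 2 (2 * a) (2 * b) \<or> D = rect 2 4 (2 * a) (2 * b)"
      by (simp add: blow_up_rect)
    thus "D \<in> brick_bases" unfolding brick_bases_def by blast
  qed
  ultimately show "set_tileable brick_bases (blow_up 2 P)" by (rule set_tileableI[rotated])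
next
  assume "set_tileable brick_bases (blow_up 2 P)"
  then obtain T where T: "T \<subseteq> brick_bases" "tiling T (blow_up 2 P)"
    unfolding set_tileable_def by blast
  obtain H where H: "\<And>D. D \<in> brick_bases \<Longrightarrow> H D \<subseteq> squares \<and> tiling (H D) D"
    using brick_base_squares unfolding set_tileable_def by metis
  have HT: "tiling (\<Union>D\<in>T. H D) (blow_up 2 P)" "(\<Union>D\<in>T. H D) \<subseteq> squares"
    using tiling_refine[OF T(2)] H T(1) by blast+
  \<comment> \<open>The square covering the lower left cell of a rectangle must have that cell as its own corner,
    since otherwise it would stick out of the rectangle.\<close>
  have even: "even a \<and> even b" if D: "rect w h a b \<in> T" "0 < w" "0 < h" for w h a b
  proof -
    let ?D = "rect w h a b"
    have D': "tiling (H ?D) ?D" "H ?D \<subseteq> squares" using H T(1) D by blast+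
    have "(a, b) \<in> ?D" using D by (simp add: rect_def)
    then obtain i j where ij: "rect 2 2 i j \<in> H ?D" "(a, b) \<in> rect 2 2 i j"
      using D' unfolding tiling_def squares_def by blast
    have "(i, j) \<in> ?D"
      using ij(1) D'(1) mem_square_iff[of i j i j] unfolding tiling_def by blast
    hence "i = a \<and> j = b" using ij(2) by (auto simp: rect_def)
    thus ?thesis using squares_blow_up_2_even[OF assms HT, of i j] ij(1) D(1) by blast
  qed
  have "T \<subseteq> blow_up 2 ` domino_cells"
  proof
    fix D assume D: "D \<in> T"
    then consider a b where "D = rect 4 2 a b" | a b where "D = rect 2 4 a b"
      using T(1) unfolding brick_bases_def by blast
    thus "D \<in> blow_up 2 ` domino_cells"
    proof cases
      case 1
      hence "even a \<and> even b" using even[of 4 2 a b] D by simp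
      hence "D = blow_up 2 (rect 2 1 (a div 2) (b div 2))" by (simp add: 1 blow_up_rect)
      thus ?thesis unfolding domino_cells_def by blast
    next
      case 2
      hence "even a \<and> even b" using even[of 2 4 a b] D by simp
      hence "D = blow_up 2 (rect 1 2 (a div 2) (b div 2))" by (simp add: 2 blow_up_rect)
      thus ?thesis unfolding domino_cells_def by blast
    qed
  qed
  then obtain U where U: "U \<subseteq> domino_cells" "T = blow_up 2 ` U" by (auto simp: subset_image_iff)
  have "tiling U P"
    using tiling_vimage[OF surj_div_pair[of 2]] T(2) unfolding U(2) blow_up_def[abs_def] by simp
  thus "set_tileable domino_cells P" using U(1) by (rule set_tileableI[rotated])
qed

lemma blow_up_3_imp_2:
  assumes "finite P" and "set_tileable brick_bases (blow_up 3 P)"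
  shows "set_tileable brick_bases (blow_up 2 P)"
proof -
  have "set_tileable squares (blow_up 3 P)"
    using assms(2) brick_base_squares by (rule set_tileable_refine)
  hence "set_tileable squares P" by (rule squares_blow_up_3)
  hence "set_tileable domino_cells P" using square_dominoes by (rule set_tileable_refine)
  thus ?thesis using blow_up_2_brick_bases_iff[OF assms(1)] by simp
qed

lemma blow_up_4_tileable:
  assumes "finite P"
  shows "set_tileable brick_bases (blow_up 4 P)"
proof -
  let ?U = "{blow_up 2 {q} | q. q \<in> P}"
  have "tiling ?U (blow_up 2 P)"
  proof (rule tilingI)
    show "\<Union>?U = blow_up 2 P" unfolding blow_up_def by blast
  qed (auto simp: blow_up_def)
  moreover have "blow_up 2 {(a, b)} = rect 2 2 (2 * a) (2 * b)" for a b
  proof -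
    have "{(a, b)} = rect 1 1 a b" by (auto simp: rect_def)
    thus ?thesis by (simp add: blow_up_rect)
  qed
  hence "?U \<subseteq> squares" unfolding squares_def by fastforce
  ultimately have "set_tileable squares (blow_up 2 P)" by (rule set_tileableI[rotated])
  hence "set_tileable domino_cells (blow_up 2 P)" using square_dominoes by (rule set_tileable_refine)
  hence "set_tileable brick_bases (blow_up 2 (blow_up 2 P))"
    using blow_up_2_brick_bases_iff finite_blow_up[OF assms] by simp
  moreover have "blow_up 2 (blow_up 2 P) = blow_up 4 P"
    unfolding blow_up_def by (auto simp: div_mult2_eq[symmetric] zdiv_zmult2_eq[symmetric])
  ultimately show ?thesis by simp
qed

theorem theorem3:
  fixes M :: "(real \<times> real \<times> real) set"
  assumes "is_model M"
  shows "(\<exists>s. 0 < s \<and> brick_tileable (scaled s M))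
       \<and> (LEAST s. 0 < s \<and> brick_tileable (scaled s M)) \<in> {1, 2, 4}
       \<and> (brick_tileable (scaled 2 M) \<longleftrightarrow> (\<forall>c. domino_tileable (footprint M c)))"
proof -
  obtain C where C: "finite C" "M = space.region C"
    using assms unfolding is_model_def space.region_def by blast
  note tileable_iff = brick_tileable_scaled_iff[OF C(1), folded C(2)]
  note finite_slices = finite_slice[OF C(1)]
  let ?good = "\<lambda>s. 0 < s \<and> brick_tileable (scaled s M)"
  have good4: "?good 4" by (simp add: tileable_iff blow_up_4_tileable finite_slices)
  have good2_if_good3: "?good 2" if "?good 3"
    using that blow_up_3_imp_2[OF finite_slices] by (simp add: tileable_iff)
  have "domino_tileable (footprint M c) \<longleftrightarrow> set_tileable domino_cells (slice c C)" for c
    unfolding C(2) footprint_region[OF C(1)] dominoes_eq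
    by (rule plane.tileable_by_region_iff) (auto intro: finite_slices finite_domino_cells)
  hence dom: "brick_tileable (scaled 2 M) \<longleftrightarrow> (\<forall>c. domino_tileable (footprint M c))"
    by (simp add: tileable_iff blow_up_2_brick_bases_iff finite_slices)
  let ?s = "LEAST s. ?good s"
  have s: "?good ?s" using good4 by (rule LeastI)
  have "?s \<le> 4" using good4 by (rule Least_le)
  moreover have "?s \<noteq> 3"
  proof
    assume "?s = 3"
    hence "?good 2" using s good2_if_good3 by metis
    hence "?s \<le> 2" by (rule Least_le)
    thus False using \<open>?s = 3\<close> by linarith
  qed
  moreover have "0 < ?s" using s by blast
  ultimately have "?s \<in> {1, 2, 4}" by (auto simp: numeral_eq_Suc le_Suc_eq)
  thus ?thesis using good4 dom by blast
qed

end
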